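(* Let $f:\mathbb{C}\to\mathbb{C}$ be an additive mapping of the complex field (linear over $\mathbb{R}$). Then there exist $a,b\in\mathbb{C}$ such that $f=a+b\circ I$, that is, $$f(z)=(a+b\circ I)\circ z=az+b\overline{z}\qquad\text{for all }z\in\mathbb{C}.$$
   Context: $I:\mathbb{C}\to\mathbb{C}$ is conjugation, $I\circ z=\overline{z}$. A complex number $a$ is identified with the mapping $z\mapsto az$, and $\circ$ denotes composition (or application) of mappings. Additive mappings of the complex field are taken to be linear over the real field. *)

theory Defs
  imports Complex_Main "HOL-Library.Function_Algebras"
begin

end

theory Submission
  imports Defs
begin

text \<open>
  A real-linear map of the plane is determined by its values at the basis vectors \<open>1\<close> and \<open>\<i>\<close>.
  The map \<open>z \<mapsto> a z + b (cnj z)\<close> takes there the values \<open>a + b\<close> and \<open>\<i> (a - b)\<close>, and any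
  two prescribed values arise in this way, since the system for \<open>a\<close> and \<open>b\<close> is invertible.
\<close>

theorem theorem2p5p1:
  fixes f :: "complex \<Rightarrow> complex"
  assumes "linear f"
  shows "\<exists>a b :: complex. f = (\<lambda>z. a * z) + ((\<lambda>z. b * z) \<circ> cnj) \<and>
           (\<forall>z. f z = a * z + b * cnj z)"
proof -
  \<comment> \<open>The solution of \<open>a + b = f 1\<close> and \<open>\<i> (a - b) = f \<i>\<close>.\<close>
  define a b where "a = (f 1 - \<i> * f \<i>) / 2" and "b = (f 1 + \<i> * f \<i>) / 2"
  have f_eq: "f z = a * z + b * cnj z" for z
  proof -
    have "z = Re z *\<^sub>R 1 + Im z *\<^sub>R \<i>"
      by (simp add: complex_eq_iff)
    then have "f z = Re z *\<^sub>R f 1 + Im z *\<^sub>R f \<i>"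
      by (metis linear_add[OF assms] linear_scale[OF assms])
    also have "\<dots> = a * z + b * cnj z"
      by (simp add: a_def b_def complex_eq_iff field_simps)
    finally show ?thesis .
  qed
  then have "f = (\<lambda>z. a * z) + ((\<lambda>z. b * z) \<circ> cnj)"
    by (simp add: fun_eq_iff)
  with f_eq show ?thesis
    by blast
qed

end
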